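(* For any Lie conformal algebra $L$ that is free as a $\mathbb{C}[\partial]$-module, $$\operatorname{Loc}(L^0)=\{f\in L^{*c}\mid \ker f\text{ contains an ideal of }L\text{ of cofinite rank}\}.$$
   Context: A Lie conformal algebra $L$ is a $\mathbb{C}[\partial]$-module with a $\mathbb{C}$-linear map $L\otimes L\to\mathbb{C}[\lambda]\otimes L$, $a\otimes b\mapsto[a_\lambda b]$, satisfying $[\partial a_\lambda b]=-\lambda[a_\lambda b]$, $[a_\lambda\partial b]=(\lambda+\partial)[a_\lambda b]$, $[a_\lambda b]=-[b_{-\lambda-\partial}\,a]$, and $[a_\lambda[b_\mu c]]=[[a_\lambda b]_{\lambda+\mu}c]+[b_\mu[a_\lambda c]]$. An ideal is a $\mathbb{C}[\partial]$-submodule $I$ with $[a_\lambda b]\in\mathbb{C}[\lambda]\otimes I$ for all $a\in L$, $b\in I$. A $\mathbb{C}[\partial]$-module has finite rank if it is of the form $\bigoplus_{i=1}^n\mathbb{C}[\partial]a_i\oplus T$ with the first summand free and $T$ the torsion submodule. An ideal $I$ has cofinite rank if $L/I$ has finite rank. The conformal dual of a $\mathbb{C}[\partial]$-module $U$ is $U^{*c}=\{f:U\to\mathbb{C}[\lambda]\mid f\ \mathbb{C}\text{-linear},\ f_\lambda(\partial u)=\lambda f_\lambda(u)\}$, with $\mathbb{C}[\partial]$-action $(\partial f)_\lambda=-\lambda f_\lambda$; $\ker f=\{u: f_\lambda(u)=0\}$. Tensor products are over $\mathbb{C}$, with $\partial(u\otimes v)=\partial u\otimes v+u\otimes\partial v$.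 A differential Lie coalgebra $(C,\delta)$ is a $\mathbb{C}[\partial]$-module $C$ with a $\mathbb{C}[\partial]$-homomorphism $\delta:C\to C\otimes C$ such that $\tau\delta=-\delta$ and $(I\otimes\delta)\delta-(\tau\otimes I)(I\otimes\delta)\delta=(\delta\otimes I)\delta$, where $\tau(a\otimes b)=b\otimes a$. A subcoalgebra is a $\mathbb{C}[\partial]$-submodule $B$ with $\delta(B)\subseteq B\otimes B$. For a differential Lie coalgebra $M$, $\operatorname{Loc}(M)$ is the sum of all finite-rank differential Lie subcoalgebras of $M$. A $\mathbb{C}[\partial]$-submodule $V\subseteq L^{*c}$ is good if for each $f\in V$ there is $\sum f_{(1)}\otimes f_{(2)}\in V\otimes V$ with $f_\lambda([a_\mu b])=\sum(f_{(1)})_{-\mu}(a)\,(f_{(2)})_{\lambda+\mu}(b)$ for all $a,b\in L$; this element is unique and is denoted $\delta_V(f)$, and $(V,\delta_V)$ is a differential Lie coalgebra. $L^0$ is the sum of all good submodules of $L^{*c}$; it is the largest good submodule, and is a differential Lie coalgebra with $\delta_{L^0}$. *)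

theory Defs
  imports "HOL-Computational_Algebra.Polynomial" "HOL-Library.Multiset"
begin

section \<open>Modules over the polynomial ring in \<open>\<partial>\<close>\<close>

text \<open>
  The ring \<open>\<complex>[\<partial>]\<close> is \<^typ>\<open>complex poly\<close>. The class is the single-carrier version of the locale
  \<^locale>\<open>module\<close> over this ring, in the same way as \<^class>\<open>real_vector\<close> is for real vector spaces.
\<close>

class del_module = ab_group_add +
  fixes pscale :: "complex poly \<Rightarrow> 'a \<Rightarrow> 'a"  (infixr "*\<^sub>\<partial>" 75)
  assumes pscale_add_right: "p *\<^sub>\<partial> (x + y) = p *\<^sub>\<partial> x + p *\<^sub>\<partial> y"
    and pscale_add_left: "(p + q) *\<^sub>\<partial> x = p *\<^sub>\<partial> x + q *\<^sub>\<partial> x"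
    and pscale_pscale: "p *\<^sub>\<partial> q *\<^sub>\<partial> x = (p * q) *\<^sub>\<partial> x"
    and pscale_one: "1 *\<^sub>\<partial> x = x"

global_interpretation pm: module "pscale :: complex poly \<Rightarrow> 'a \<Rightarrow> 'a::del_module"
  by unfold_locales (simp_all add: pscale_add_right pscale_add_left pscale_pscale pscale_one)

abbreviation cscale :: "complex \<Rightarrow> 'a::del_module \<Rightarrow> 'a"
  where "cscale c x \<equiv> [:c:] *\<^sub>\<partial> x"

abbreviation del :: "'a::del_module \<Rightarrow> 'a"
  where "del x \<equiv> [:0, 1:] *\<^sub>\<partial> x"

text \<open>
  For submodules \<open>N \<subseteq> M\<close>, the preimage in \<open>M\<close> of the torsion submodule of the quotient \<open>M/N\<close>.
\<close>

definition torsion_mod :: "'a::del_module set \<Rightarrow> 'a set \<Rightarrow> 'a set"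
  where "torsion_mod M N = {x \<in> M. \<exists>p. p \<noteq> 0 \<and> p *\<^sub>\<partial> x \<in> N}"

text \<open>
  For submodules \<open>N \<subseteq> M\<close>: the quotient \<open>M/N\<close> has finite rank, i.e. it is the direct sum of a free
  module on the classes of \<open>a 0, \<dots>, a (n - 1)\<close> and of its torsion submodule. The second conjunct
  says that these classes are linearly independent; the sum with the torsion submodule is then
  automatically direct. The third conjunct is an equation in \<open>M\<close> because \<open>N \<subseteq> torsion_mod M N\<close>.
\<close>

definition finite_rank_quotient :: "'a::del_module set \<Rightarrow> 'a set \<Rightarrow> bool"
  where "finite_rank_quotient M N \<longleftrightarrow>
    (\<exists>(n::nat) (a :: nat \<Rightarrow> 'a).
       (\<forall>i<n. a i \<in> M) \<and>
       (\<forall>p. (\<Sum>i<n. p i *\<^sub>\<partial> a i) \<in> N \<longrightarrow> (\<forall>i<n. p i = 0)) \<and>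
       (\<forall>x\<in>M. \<exists>p. \<exists>t\<in>torsion_mod M N. x = (\<Sum>i<n. p i *\<^sub>\<partial> a i) + t))"

definition finite_rank :: "'a::del_module set \<Rightarrow> bool"
  where "finite_rank M \<longleftrightarrow> finite_rank_quotient M {0}"

definition cofinite_rank :: "'a::del_module set \<Rightarrow> bool"
  where "cofinite_rank I \<longleftrightarrow> finite_rank_quotient UNIV I"


section \<open>Lie conformal algebras\<close>

text \<open>
  An element of \<open>\<complex>[\<lambda>] \<otimes> L\<close> is a polynomial with coefficients in \<open>L\<close>, and an element of
  \<open>\<complex>[\<lambda>,\<mu>] \<otimes> L\<close> is a value of type \<open>'l poly poly\<close> whose outer variable is \<open>\<mu>\<close> and whose inner
  variable is \<open>\<lambda>\<close>. For \<open>q = \<Sum>n. x\<^sup>n c\<^sub>n\<close>, \<open>poly_act X h q\<close> is \<open>\<Sum>n. X\<^sup>n (h c\<^sub>n)\<close>: the variable of \<open>q\<close>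
  is replaced by the operator \<open>X\<close> after the coefficients have been mapped by \<open>h\<close>.
\<close>

definition poly_act :: "('b \<Rightarrow> 'b) \<Rightarrow> ('a \<Rightarrow> 'b) \<Rightarrow> 'a::zero poly \<Rightarrow> 'b::comm_monoid_add"
  where "poly_act X h q = (\<Sum>n\<le>degree q. (X ^^ n) (h (coeff q n)))"

definition mult_lambda :: "'l::zero poly poly \<Rightarrow> 'l poly poly"
  where "mult_lambda r = map_poly (pCons 0) r"

definition mult_mu :: "'l::zero poly poly \<Rightarrow> 'l poly poly"
  where "mult_mu r = pCons 0 r"

text \<open>
  \<open>bracket_at br X a b\<close> is \<open>[a\<^sub>X b]\<close> in \<open>\<complex>[\<lambda>,\<mu>] \<otimes> L\<close>, for \<open>X\<close> one of \<open>\<lambda>\<close>, \<open>\<mu>\<close>, \<open>\<lambda> + \<mu>\<close>.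
\<close>

definition bracket_at ::
    "('l::comm_monoid_add \<Rightarrow> 'l \<Rightarrow> 'l poly) \<Rightarrow> ('l poly poly \<Rightarrow> 'l poly poly) \<Rightarrow>
     'l \<Rightarrow> 'l \<Rightarrow> 'l poly poly"
  where "bracket_at br X a b = poly_act X (\<lambda>c. [:[:c:]:]) (br a b)"

locale lie_conformal_algebra =
  fixes br :: "'l::del_module \<Rightarrow> 'l \<Rightarrow> 'l poly"
  assumes add_left: "br (a + a') b = br a b + br a' b"
    and add_right: "br a (b + b') = br a b + br a b'"
    and cscale_left: "br (cscale k a) b = map_poly (cscale k) (br a b)"
    and cscale_right: "br a (cscale k b) = map_poly (cscale k) (br a b)"
    and sesquilinear_left: "br (del a) b = - pCons 0 (br a b)"
    and sesquilinear_right: "br a (del b) = pCons 0 (br a b) + map_poly del (br a b)"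
    and skew_symmetry:
      "br a b = - poly_act (\<lambda>r. - pCons 0 r - map_poly del r) (\<lambda>c. [:c:]) (br b a)"
    and jacobi:
      "poly_act mult_mu (bracket_at br mult_lambda a) (br b c) =
       poly_act mult_lambda
         (\<lambda>x. bracket_at br (\<lambda>r. mult_lambda r + mult_mu r) x c) (br a b) +
       poly_act mult_lambda (bracket_at br mult_mu b) (br a c)"

definition lca_ideal :: "('l::del_module \<Rightarrow> 'l \<Rightarrow> 'l poly) \<Rightarrow> 'l set \<Rightarrow> bool"
  where "lca_ideal br I \<longleftrightarrow> pm.subspace I \<and> (\<forall>a. \<forall>b\<in>I. \<forall>n. coeff (br a b) n \<in> I)"


section \<open>Conformal dual\<close>

text \<open>
  \<^term>\<open>cd_eval f u\<close> is the polynomial \<open>f\<^sub>\<lambda>(u)\<close>.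
\<close>

typedef (overloaded) 'l conformal_dual =
  "{f :: 'l::del_module \<Rightarrow> complex poly.
      (\<forall>u v. f (u + v) = f u + f v) \<and>
      (\<forall>c u. f (cscale c u) = smult c (f u)) \<and>
      (\<forall>u. f (del u) = [:0, 1:] * f u)}"
  morphisms cd_eval Abs_cd
  by (rule exI[of _ "\<lambda>_. 0"]) simp

setup_lifting type_definition_conformal_dual

text \<open>
  Since \<open>(\<partial> f)\<^sub>\<lambda> = - \<lambda> f\<^sub>\<lambda>\<close>, a polynomial \<open>p(\<partial>)\<close> acts by multiplication with \<open>p(- \<lambda>)\<close>.
\<close>

instantiation conformal_dual :: (del_module) del_module
begin

lift_definition zero_conformal_dual :: "'a conformal_dual" is "\<lambda>_. 0" by simp
lift_definition plus_conformal_dual :: "'a conformal_dual \<Rightarrow> 'a conformal_dual \<Rightarrow> 'a conformal_dual"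
  is "\<lambda>f g u. f u + g u" by (simp add: algebra_simps smult_add_right)
lift_definition uminus_conformal_dual :: "'a conformal_dual \<Rightarrow> 'a conformal_dual"
  is "\<lambda>f u. - f u" by simp
lift_definition minus_conformal_dual :: "'a conformal_dual \<Rightarrow> 'a conformal_dual \<Rightarrow> 'a conformal_dual"
  is "\<lambda>f g u. f u - g u" by (simp add: algebra_simps smult_diff_right)
lift_definition pscale_conformal_dual :: "complex poly \<Rightarrow> 'a conformal_dual \<Rightarrow> 'a conformal_dual"
  is "\<lambda>p f u. pcompose p [:0, -1:] * f u" by (simp add: algebra_simps)

instance
  by standard
    (transfer; simp add: fun_eq_iff algebra_simps pcompose_add pcompose_mult pcompose_1)+

end

definition cd_ker :: "'l::del_module conformal_dual \<Rightarrow> 'l set"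
  where "cd_ker f = {u. cd_eval f u = 0}"


section \<open>Tensor products over the complex numbers\<close>

text \<open>
  Formal sums of pairs are finite multisets, and the tensor product is their quotient by the least
  congruence that makes the pair of \<open>v\<close> and \<open>w\<close> biadditive and \<open>\<complex>\<close>-balanced. Formal negatives are not
  needed, as \<open>- (v \<otimes> w)\<close> is the class of the pair \<open>(- v, w)\<close>.
\<close>

inductive tensor_rel ::
    "('v::del_module \<times> 'w::del_module) multiset \<Rightarrow> ('v \<times> 'w) multiset \<Rightarrow> bool"
  where
    tensor_refl: "tensor_rel A A"
  | tensor_sym: "tensor_rel A B \<Longrightarrow> tensor_rel B A"
  | tensor_trans: "tensor_rel A B \<Longrightarrow> tensor_rel B C \<Longrightarrow> tensor_rel A C"
  | tensor_cong: "tensor_rel A B \<Longrightarrow> tensor_rel (A + C) (B + C)"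
  | tensor_zero: "tensor_rel {#(0, w)#} {#}"
  | tensor_add_left: "tensor_rel {#(v + v', w)#} {#(v, w), (v', w)#}"
  | tensor_add_right: "tensor_rel {#(v, w + w')#} {#(v, w), (v, w')#}"
  | tensor_balanced: "tensor_rel {#(cscale c v, w)#} {#(v, cscale c w)#}"

lemma equivp_tensor_rel: "equivp tensor_rel"
  by (rule equivpI) (auto intro!: reflpI sympI transpI intro: tensor_rel.intros)

lemma tensor_cong2:
  assumes "tensor_rel A B" "tensor_rel C D"
  shows "tensor_rel (A + C) (B + D)"
  using tensor_cong[OF assms(1), of C] tensor_cong[OF assms(2), of B]
  by (metis add.commute tensor_trans)

definition tensor_neg :: "('v::del_module \<times> 'w::del_module) multiset \<Rightarrow> ('v \<times> 'w) multiset"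
  where "tensor_neg A = image_mset (\<lambda>(v, w). (- v, w)) A"

lemma tensor_rel_neg: "tensor_rel A B \<Longrightarrow> tensor_rel (tensor_neg A) (tensor_neg B)"
proof (induction rule: tensor_rel.induct)
  case (tensor_add_left v v' w)
  then show ?case
    using tensor_rel.tensor_add_left[of "- v" "- v'" w] by (simp add: tensor_neg_def)
next
  case (tensor_balanced c v w)
  then show ?case
    using tensor_rel.tensor_balanced[of c "- v" w] by (simp add: tensor_neg_def)
qed (auto simp: tensor_neg_def intro: tensor_rel.intros)

lemma tensor_rel_neg_add: "tensor_rel (tensor_neg A + A) {#}"
proof (induction A)
  case empty
  then show ?case by (simp add: tensor_neg_def tensor_refl)
next
  case (add x A)
  obtain v w where x: "x = (v, w)" by fastforce
  have "tensor_rel {#(- v, w), (v, w)#} {#}"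
    using tensor_add_left[of "- v" v w] tensor_zero by (auto intro: tensor_sym tensor_trans)
  from tensor_cong2[OF this add] show ?case
    by (simp add: x tensor_neg_def add_mset_commute)
qed

quotient_type (overloaded) ('v, 'w) tensor =
  "('v::del_module \<times> 'w::del_module) multiset" / tensor_rel
  by (rule equivp_tensor_rel)

instantiation tensor :: (del_module, del_module) ab_group_add
begin

lift_definition zero_tensor :: "('a, 'b) tensor" is "{#}" .
lift_definition plus_tensor :: "('a, 'b) tensor \<Rightarrow> ('a, 'b) tensor \<Rightarrow> ('a, 'b) tensor"
  is "(+)" by (rule tensor_cong2)
lift_definition uminus_tensor :: "('a, 'b) tensor \<Rightarrow> ('a, 'b) tensor"
  is tensor_neg by (rule tensor_rel_neg)
definition minus_tensor :: "('a, 'b) tensor \<Rightarrow> ('a, 'b) tensor \<Rightarrow> ('a, 'b) tensor"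
  where "minus_tensor s t = s + - t"

instance
proof
  fix a b c :: "('a, 'b) tensor"
  show "a + b + c = a + (b + c)" by transfer (simp add: add.assoc tensor_refl)
  show "a + b = b + a" by transfer (simp add: add.commute tensor_refl)
  show "0 + a = a" by transfer (simp add: tensor_refl)
  show "- a + a = 0" by transfer (rule tensor_rel_neg_add)
  show "a - b = a + - b" by (rule minus_tensor_def)
qed

end

lift_definition pure_tensor :: "'v::del_module \<Rightarrow> 'w::del_module \<Rightarrow> ('v, 'w) tensor"  (infixr "\<otimes>" 70)
  is "\<lambda>v w. {#(v, w)#}" .

text \<open>
  The subspace \<open>V \<otimes> W\<close> of the tensor product of the ambient modules; over a field the canonical map
  from the tensor product of the subspaces \<open>V\<close> and \<open>W\<close> to it is an isomorphism.
\<close>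

definition tensor_sub :: "'v::del_module set \<Rightarrow> 'w::del_module set \<Rightarrow> ('v, 'w) tensor set"
  where "tensor_sub V W =
    {t. \<exists>(n::nat) v w. (\<forall>i<n. v i \<in> V \<and> w i \<in> W) \<and> t = (\<Sum>i<n. v i \<otimes> w i)}"

definition balanced_map :: "('v::del_module \<Rightarrow> 'w::del_module \<Rightarrow> 'b::ab_group_add) \<Rightarrow> bool"
  where "balanced_map \<beta> \<longleftrightarrow>
    (\<forall>v v' w. \<beta> (v + v') w = \<beta> v w + \<beta> v' w) \<and>
    (\<forall>v w w'. \<beta> v (w + w') = \<beta> v w + \<beta> v w') \<and>
    (\<forall>c v w. \<beta> (cscale c v) w = \<beta> v (cscale c w))"

text \<open>
  The additive map on the tensor product induced by a balanced map. The value for a map that is not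
  balanced is irrelevant.
\<close>

lift_definition tensor_lift ::
    "('v::del_module \<Rightarrow> 'w::del_module \<Rightarrow> 'b::ab_group_add) \<Rightarrow> ('v, 'w) tensor \<Rightarrow> 'b"
  is "\<lambda>\<beta> A. if balanced_map \<beta> then (\<Sum>(v, w)\<in>#A. \<beta> v w) else 0"
proof -
  fix \<beta> :: "'v \<Rightarrow> 'w \<Rightarrow> 'b" and A B :: "('v \<times> 'w) multiset"
  assume "tensor_rel A B"
  moreover have "tensor_rel A B \<Longrightarrow> (\<Sum>(v, w)\<in>#A. \<beta> v w) = (\<Sum>(v, w)\<in>#B. \<beta> v w)" if "balanced_map \<beta>"
  proof (induction rule: tensor_rel.induct)
    case (tensor_zero w)
    have "\<beta> (0 + 0) w = \<beta> 0 w + \<beta> 0 w"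
      using that unfolding balanced_map_def by blast
    then show ?case by simp
  qed (use that in \<open>auto simp: balanced_map_def\<close>)
  ultimately show "(if balanced_map \<beta> then (\<Sum>(v, w)\<in>#A. \<beta> v w) else 0) =
      (if balanced_map \<beta> then (\<Sum>(v, w)\<in>#B. \<beta> v w) else 0)"
    by simp
qed

lemma tensor_lift_pure: "balanced_map \<beta> \<Longrightarrow> tensor_lift \<beta> (v \<otimes> w) = \<beta> v w"
  by transfer simp

lemma tensor_lift_add: "tensor_lift \<beta> (s + t) = tensor_lift \<beta> s + tensor_lift \<beta> t"
  by transfer simp


section \<open>Good submodules and their coproduct\<close>

text \<open>
  \<open>\<complex>[\<lambda>,\<mu>]\<close> is \<^typ>\<open>complex poly poly\<close> with outer variable \<open>\<mu>\<close> and inner variable \<open>\<lambda>\<close>;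
  \<open>subst2 q r\<close> is the one-variable polynomial \<open>q\<close> evaluated at \<open>r\<close>.
\<close>

abbreviation var_lambda :: "complex poly poly" where "var_lambda \<equiv> [:[:0, 1:]:]"
abbreviation var_mu :: "complex poly poly" where "var_mu \<equiv> [:0, 1:]"

definition subst2 :: "complex poly \<Rightarrow> complex poly poly \<Rightarrow> complex poly poly"
  where "subst2 q r = poly (map_poly (\<lambda>c. [:[:c:]:]) q) r"

text \<open>
  For \<open>t = \<Sum> f\<^sub>1 \<otimes> f\<^sub>2\<close> this is \<open>\<Sum> (f\<^sub>1)\<^bsub>-\<mu>\<^esub>(a) (f\<^sub>2)\<^bsub>\<lambda>+\<mu>\<^esub>(b)\<close>.
\<close>

definition tensor_eval ::
    "'l::del_module \<Rightarrow> 'l \<Rightarrow> ('l conformal_dual, 'l conformal_dual) tensor \<Rightarrow> complex poly poly"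
  where "tensor_eval a b =
    tensor_lift (\<lambda>f g. subst2 (cd_eval f a) (- var_mu) * subst2 (cd_eval g b) (var_lambda + var_mu))"

lemma subst2_add: "subst2 (p + q) r = subst2 p r + subst2 q r"
proof -
  have "map_poly (\<lambda>c. [:[:c:]:]) (p + q) =
      map_poly (\<lambda>c. [:[:c:]:]) p + map_poly (\<lambda>c. [:[:c:]:]) q"
    by (rule poly_eqI) (simp add: coeff_map_poly)
  then show ?thesis by (simp add: subst2_def)
qed

lemma subst2_smult: "subst2 (smult c p) r = [:[:c:]:] * subst2 p r"
proof -
  have "map_poly (\<lambda>c. [:[:c:]:]) (smult c p) = smult [:[:c:]:] (map_poly (\<lambda>c. [:[:c:]:]) p)"
    by (rule poly_eqI) (simp add: coeff_map_poly mult.commute)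
  then show ?thesis by (simp add: subst2_def)
qed

lemma cd_eval_add: "cd_eval (f + g) u = cd_eval f u + cd_eval g u"
  by transfer simp

lemma cd_eval_pscale: "cd_eval (p *\<^sub>\<partial> f) u = pcompose p [:0, -1:] * cd_eval f u"
  by transfer simp

lemma balanced_tensor_eval:
  "balanced_map (\<lambda>f g. subst2 (cd_eval f a) (- var_mu) *
     subst2 (cd_eval g b) (var_lambda + var_mu))"
  unfolding balanced_map_def
  by (simp add: cd_eval_add cd_eval_pscale subst2_add subst2_smult distrib_left distrib_right)

lemma tensor_eval_pure:
  "tensor_eval a b (f \<otimes> g) =
     subst2 (cd_eval f a) (- var_mu) * subst2 (cd_eval g b) (var_lambda + var_mu)"
  unfolding tensor_eval_def by (rule tensor_lift_pure[OF balanced_tensor_eval])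

text \<open>
  \<open>is_coproduct br V f t\<close>: the tensor \<open>t \<in> V \<otimes> V\<close> satisfies
  \<open>f\<^sub>\<lambda>([a\<^sub>\<mu> b]) = \<Sum> (f\<^sub>1)\<^bsub>-\<mu>\<^esub>(a) (f\<^sub>2)\<^bsub>\<lambda>+\<mu>\<^esub>(b)\<close> for all \<open>a\<close> and \<open>b\<close>. On the left the bracket is a
  polynomial in \<open>\<mu>\<close>, to whose coefficients \<open>f\<^sub>\<lambda>\<close> is applied.
\<close>

definition is_coproduct ::
    "('l::del_module \<Rightarrow> 'l \<Rightarrow> 'l poly) \<Rightarrow> 'l conformal_dual set \<Rightarrow> 'l conformal_dual \<Rightarrow>
     ('l conformal_dual, 'l conformal_dual) tensor \<Rightarrow> bool"
  where "is_coproduct br V f t \<longleftrightarrow>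
    t \<in> tensor_sub V V \<and> (\<forall>a b. map_poly (cd_eval f) (br a b) = tensor_eval a b t)"

definition good :: "('l::del_module \<Rightarrow> 'l \<Rightarrow> 'l poly) \<Rightarrow> 'l conformal_dual set \<Rightarrow> bool"
  where "good br V \<longleftrightarrow> pm.subspace V \<and> (\<forall>f\<in>V. \<exists>t. is_coproduct br V f t)"

definition good_coproduct ::
    "('l::del_module \<Rightarrow> 'l \<Rightarrow> 'l poly) \<Rightarrow> 'l conformal_dual set \<Rightarrow> 'l conformal_dual \<Rightarrow>
     ('l conformal_dual, 'l conformal_dual) tensor"
  where "good_coproduct br V f = (THE t. is_coproduct br V f t)"

text \<open>
  The sum of a family of submodules is the span of their union.
\<close>

definition upper_zero :: "('l::del_module \<Rightarrow> 'l \<Rightarrow> 'l poly) \<Rightarrow> 'l conformal_dual set"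
  where "upper_zero br = pm.span (\<Union>{V. good br V})"


section \<open>Finite-rank subcoalgebras\<close>

text \<open>
  A differential Lie coalgebra is given by a carrier \<open>C\<close>, a submodule of the ambient module, and a
  map \<open>\<delta>\<close> of which only the values on \<open>C\<close> matter. A submodule \<open>B\<close> with \<open>\<delta>(B) \<subseteq> B \<otimes> B\<close> inherits
  \<open>\<partial>\<close>-linearity, antisymmetry and the co-Jacobi identity from \<open>C\<close>, so these axioms do not occur in
  the definitions of subcoalgebras and of \<open>Loc\<close>.
\<close>

definition subcoalgebra ::
    "'c::del_module set \<Rightarrow> ('c \<Rightarrow> ('c, 'c) tensor) \<Rightarrow> 'c set \<Rightarrow> bool"
  where "subcoalgebra C \<delta> B \<longleftrightarrow> pm.subspace B \<and> B \<subseteq> C \<and> \<delta> ` B \<subseteq> tensor_sub B B"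

definition Loc :: "'c::del_module set \<Rightarrow> ('c \<Rightarrow> ('c, 'c) tensor) \<Rightarrow> 'c set"
  where "Loc C \<delta> = pm.span (\<Union>{B. subcoalgebra C \<delta> B \<and> finite_rank B})"

end

theory Submission
  imports Defs
begin

text \<open>
  A finite-rank submodule of the torsion-free module \<open>L\<^sup>*\<^sup>c\<close> is generated by a finite set \<open>G\<close>. If it is
  good, the common kernel of \<open>G\<close> is an ideal, and its quotient embeds into a finite power of the
  principal ideal domain \<open>\<complex>[\<lambda>]\<close>, so it is free of finite rank. Conversely, the
  functionals that vanish on an ideal \<open>I\<close> with \<open>L/I = \<Oplus> \<complex>[\<partial>] a\<^sub>i \<oplus> T\<close> are freely generated by the
  coordinate functionals \<open>e\<^sub>i\<close>. By sesquilinearity \<open>f\<^sub>\<lambda>([a\<^sub>\<mu> b])\<close> is determined by its values at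
  the pairs \<open>(a\<^sub>i, a\<^sub>j)\<close>, and expanding these in the variables \<open>-\<mu>\<close> and \<open>\<lambda> + \<mu>\<close> yields the
  coproduct of \<open>f\<close>.
\<close>

section \<open>Substitution and conformal functionals\<close>

lemma smult_const_1 [simp]: "smult [:1 :: 'a::comm_semiring_1:] p = p"
  by (simp flip: one_pCons)

lemma subst2_0 [simp]: "subst2 0 r = 0"
  by (simp add: subst2_def)

lemma subst2_pCons: "subst2 (pCons c p) r = [:[:c:]:] + r * subst2 p r"
  by (simp add: subst2_def map_poly_pCons)

text \<open>Evaluation at \<mu> = \<open>z\<close> and \<lambda> = \<open>w\<close>; it reduces
  identities in two variables to identities between numbers.\<close>

lemma poly_subst2: "poly (poly (subst2 p r) [:z:]) w = poly p (poly (poly r [:z:]) w)"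
  by (induction p) (simp_all add: subst2_pCons)

text \<open>Both substituted forms take every complex value, so a polynomial in the kernel has every
  number as a root.\<close>

lemma subst2_neg_mu_eq_0: "subst2 p (- var_mu) = 0 \<Longrightarrow> p = 0"
  and subst2_lambda_mu_eq_0: "subst2 q (var_lambda + var_mu) = 0 \<Longrightarrow> q = 0"
proof -
  assume *: "subst2 p (- var_mu) = 0"
  have "poly p x = 0" for x
    using poly_subst2[of p "- var_mu" "- x" 0] * by simp
  then show "p = 0" using poly_all_0_iff_0 by blast
next
  assume *: "subst2 q (var_lambda + var_mu) = 0"
  have "poly q x = 0" for x
    using poly_subst2[of q "var_lambda + var_mu" 0 x] * by simp
  then show "q = 0" using poly_all_0_iff_0 by blast
qed

lemma cd_eval_arg_add: "cd_eval f (u + v) = cd_eval f u + cd_eval f v"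
  and cd_eval_cscale: "cd_eval f (cscale c u) = smult c (cd_eval f u)"
  and cd_eval_del: "cd_eval f (del u) = [:0, 1:] * cd_eval f u"
  by (transfer; simp)+

lemma cd_eval_zero [simp]: "cd_eval 0 u = 0"
  by transfer simp

lemma cd_eval_arg_zero [simp]: "cd_eval f 0 = 0"
  using cd_eval_arg_add[of f 0 0] by simp

lemma cd_eval_arg_diff: "cd_eval f (u - v) = cd_eval f u - cd_eval f v"
  using cd_eval_arg_add[of f "u - v" v] by simp

lemma cd_eval_sum: "cd_eval (\<Sum>i\<in>A. f i) u = (\<Sum>i\<in>A. cd_eval (f i) u)"
  by (induction A rule: infinite_finite_induct) (simp_all add: cd_eval_add)

lemma cd_eval_arg_sum: "cd_eval f (\<Sum>i\<in>A. u i) = (\<Sum>i\<in>A. cd_eval f (u i))"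
  by (induction A rule: infinite_finite_induct) (simp_all add: cd_eval_arg_add)

lemma cd_eqI: "(\<And>u. cd_eval f u = cd_eval g u) \<Longrightarrow> f = g"
  using cd_eval_inject by blast

text \<open>This is the induction step for polynomial scalars: the axioms for functionals and
  brackets speak only of \<open>cscale\<close> and \<open>del\<close>.\<close>

lemma pscale_pCons: "pCons c p *\<^sub>\<partial> u = cscale c u + del (p *\<^sub>\<partial> u)"
proof -
  have "pCons c p = [:c:] + [:0, 1:] * p" by simp
  then show ?thesis by (simp only: pscale_add_left pscale_pscale)
qed

lemma cd_eval_arg_pscale: "cd_eval f (p *\<^sub>\<partial> u) = p * cd_eval f u"
proof (induction p)
  case (pCons c p)
  have "cd_eval f (pCons c p *\<^sub>\<partial> u) = smult c (cd_eval f u) + [:0, 1:] * (p * cd_eval f u)"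
    by (simp only: pscale_pCons[of c p] cd_eval_arg_add cd_eval_cscale cd_eval_del pCons.IH)
  then show ?case by simp
qed simp

lemma subspace_cd_ker: "pm.subspace (cd_ker f)"
  by (auto simp: pm.subspace_def cd_ker_def cd_eval_arg_add cd_eval_arg_pscale)

lemma subspace_annihilator: "pm.subspace {g. I \<subseteq> cd_ker g}"
  by (auto simp: pm.subspace_def cd_ker_def cd_eval_add cd_eval_pscale subset_iff)

text \<open>The action of \<open>p\<close> multiplies all values by p(-\<lambda>), which is nonzero
  in an integral domain.\<close>

lemma conformal_dual_torsion_free:
  fixes f :: "'l::del_module conformal_dual"
  assumes "p *\<^sub>\<partial> f = 0" "p \<noteq> 0"
  shows "f = 0"
proof (rule cd_eqI)
  fix u
  have "pcompose p [:0, -1:] \<noteq> 0"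
    using assms(2) by (simp add: pcompose_eq_0_iff)
  then show "cd_eval f u = cd_eval 0 u"
    using cd_eval_pscale[of p f u] assms(1) by simp
qed


section \<open>Uniqueness of coproducts\<close>

lemma tensor_lift_0 [simp]: "tensor_lift \<beta> 0 = 0"
  using tensor_lift_add[of \<beta> 0 0] by simp

lemma tensor_eval_0 [simp]: "tensor_eval a b 0 = 0"
  by (simp add: tensor_eval_def)

lemma tensor_eval_add: "tensor_eval a b (s + t) = tensor_eval a b s + tensor_eval a b t"
  by (simp add: tensor_eval_def tensor_lift_add)

lemma tensor_eval_sum: "tensor_eval a b (\<Sum>i\<in>A. t i) = (\<Sum>i\<in>A. tensor_eval a b (t i))"
  by (induction A rule: infinite_finite_induct) (simp_all add: tensor_eval_add)

lemma tensor_eval_diff: "tensor_eval a b (s - t) = tensor_eval a b s - tensor_eval a b t"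
  using tensor_eval_add[of a b "s - t" t] by simp

section \<open>Pure tensors and the subspaces they generate\<close>

lemma pure_add_left: "(v + v') \<otimes> w = v \<otimes> w + v' \<otimes> w"
  by transfer (metis tensor_add_left add_mset_add_single add.commute)

lemma pure_add_right: "v \<otimes> (w + w') = v \<otimes> w + v \<otimes> w'"
  by transfer (metis tensor_add_right add_mset_add_single add.commute)

lemma pure_cscale: "cscale c v \<otimes> w = v \<otimes> cscale c w"
  by transfer (rule tensor_balanced)

lemma pure_0_left [simp]: "0 \<otimes> w = 0"
  using pure_add_left[of 0 0 w] by simp

lemma pure_0_right [simp]: "v \<otimes> 0 = 0"
  using pure_add_right[of v 0 0] by simp

lemma pure_neg_left: "(- v) \<otimes> w = - (v \<otimes> w)"
  using pure_add_left[of "- v" v w] by (simp add: eq_neg_iff_add_eq_0)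

lemma pure_sum_left: "(\<Sum>i\<in>A. v i) \<otimes> w = (\<Sum>i\<in>A. v i \<otimes> w)"
  by (induction A rule: infinite_finite_induct) (simp_all add: pure_add_left)

lemma tensor_subI:
  fixes v :: "nat \<Rightarrow> 'v::del_module" and w :: "nat \<Rightarrow> 'w::del_module"
  assumes "\<And>i. i < n \<Longrightarrow> v i \<in> V \<and> w i \<in> W"
  shows "(\<Sum>i<n. v i \<otimes> w i) \<in> tensor_sub V W"
  using assms unfolding tensor_sub_def by blast

lemma tensor_sub_mono: "V \<subseteq> V' \<Longrightarrow> W \<subseteq> W' \<Longrightarrow> tensor_sub V W \<subseteq> tensor_sub V' W'"
  unfolding tensor_sub_def by blast

lemma tensor_sub_0: "0 \<in> tensor_sub V W"
  unfolding tensor_sub_def by (auto intro!: exI[of _ "0::nat"])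

lemma tensor_sub_pure: "v \<in> V \<Longrightarrow> w \<in> W \<Longrightarrow> v \<otimes> w \<in> tensor_sub V W"
  unfolding tensor_sub_def by (auto intro!: exI[of _ "1::nat"] exI[of _ "\<lambda>_. v"] exI[of _ "\<lambda>_. w"])

lemma tensor_sub_add:
  assumes "s \<in> tensor_sub V W" "t \<in> tensor_sub V W"
  shows "s + t \<in> tensor_sub V W"
proof -
  obtain m :: nat and v w where 1: "\<And>i. i < m \<Longrightarrow> v i \<in> V \<and> w i \<in> W" "s = (\<Sum>i<m. v i \<otimes> w i)"
    using assms(1) unfolding tensor_sub_def by blast
  obtain n :: nat and v' w' where 2: "\<And>i. i < n \<Longrightarrow> v' i \<in> V \<and> w' i \<in> W" "t = (\<Sum>i<n. v' i \<otimes> w' i)"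
    using assms(2) unfolding tensor_sub_def by blast
  let ?v = "\<lambda>i. if i < m then v i else v' (i - m)"
  let ?w = "\<lambda>i. if i < m then w i else w' (i - m)"
  have "(\<Sum>i<m + n. ?v i \<otimes> ?w i) = (\<Sum>i<m. ?v i \<otimes> ?w i) + (\<Sum>i<n. ?v (m + i) \<otimes> ?w (m + i))"
    by (induction n) (simp_all add: add.assoc)
  also have "\<dots> = s + t" using 1 2 by simp
  finally have eq: "s + t = (\<Sum>i<m + n. ?v i \<otimes> ?w i)" by (rule sym)
  show ?thesis
    unfolding eq by (rule tensor_subI) (use 1(1) 2(1) in simp)
qed

lemma tensor_sub_sum: "(\<And>i. i \<in> A \<Longrightarrow> t i \<in> tensor_sub V W) \<Longrightarrow> (\<Sum>i\<in>A. t i) \<in> tensor_sub V W"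
  by (induction A rule: infinite_finite_induct) (simp_all add: tensor_sub_0 tensor_sub_add)

lemma tensor_sub_uminus:
  assumes "pm.subspace V" "t \<in> tensor_sub V W"
  shows "- t \<in> tensor_sub V W"
proof -
  obtain n :: nat and v w where 1: "\<And>i. i < n \<Longrightarrow> v i \<in> V \<and> w i \<in> W" "t = (\<Sum>i<n. v i \<otimes> w i)"
    using assms(2) unfolding tensor_sub_def by blast
  have "- t = (\<Sum>i<n. (- v i) \<otimes> w i)"
    by (simp add: 1 sum_negf pure_neg_left)
  then show ?thesis
    using 1 assms(1) by (auto intro!: tensor_sub_sum tensor_sub_pure pm.subspace_neg)
qed

text \<open>The forms -\<mu> and \<lambda> + \<mu> are independent coordinates x and y, so the
  coefficient of each power of y vanishes as a polynomial in x.\<close>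

lemma separated_coeff_eq_0:
  assumes "(\<Sum>i\<in>J. subst2 (p i) (- var_mu) * subst2 (q i) (var_lambda + var_mu)) = 0"
  shows "(\<Sum>i\<in>J. smult (coeff (q i) l) (p i)) = 0"
proof -
  have "(\<Sum>i\<in>J. poly (p i) x * poly (q i) y) = 0" for x y
  proof -
    \<comment> \<open>The point \<mu> = -x, \<lambda> = x + y is the one where -\<mu> equals x and
      \<lambda> + \<mu> equals y.\<close>
    have "poly (poly (\<Sum>i\<in>J. subst2 (p i) (- var_mu) * subst2 (q i) (var_lambda + var_mu)) [:- x:]) (x + y) =
      (\<Sum>i\<in>J. poly (p i) x * poly (q i) y)"
      by (simp add: poly_sum poly_subst2)
    then show ?thesis using assms by simp
  qed
  then have "poly (\<Sum>i\<in>J. smult (poly (p i) x) (q i)) y = 0" for x y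
    by (simp add: poly_sum)
  then have "(\<Sum>i\<in>J. smult (poly (p i) x) (q i)) = 0" for x
    using poly_all_0_iff_0 by blast
  then have "coeff (\<Sum>i\<in>J. smult (poly (p i) x) (q i)) l = 0" for x
    by simp
  then have "poly (\<Sum>i\<in>J. smult (coeff (q i) l) (p i)) x = 0" for x
    by (simp add: poly_sum coeff_sum mult.commute)
  then show ?thesis using poly_all_0_iff_0 by blast
qed

text \<open>
  If some coefficient of the right factors does not vanish, it gives a linear relation between the
  left factors, which shortens the sum.
\<close>

lemma pure_sum_eq_0:
  fixes v w :: "'i \<Rightarrow> 'l::del_module conformal_dual"
  assumes "finite J" "\<And>a b. tensor_eval a b (\<Sum>i\<in>J. v i \<otimes> w i) = 0"
  shows "(\<Sum>i\<in>J. v i \<otimes> w i) = 0"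
  using assms
\<comment> \<open>The left factors \<open>v\<close> stay fixed: removing an index alters only the
  right factors.\<close>
proof (induction "card J" arbitrary: J w)
  case 0
  then show ?case by simp
next
  case (Suc n)
  have rel: "(\<Sum>i\<in>J. cscale (coeff (cd_eval (w i) b) l) (v i)) = 0" for b l
  proof (rule cd_eqI)
    fix a
    have "(\<Sum>i\<in>J. smult (coeff (cd_eval (w i) b) l) (cd_eval (v i) a)) = 0"
      by (rule separated_coeff_eq_0) (use Suc.prems in \<open>simp add: tensor_eval_sum tensor_eval_pure\<close>)
    then show "cd_eval (\<Sum>i\<in>J. cscale (coeff (cd_eval (w i) b) l) (v i)) a = cd_eval 0 a"
      by (simp add: cd_eval_sum cd_eval_pscale)
  qed
  show ?case
  proof (cases "\<forall>i\<in>J. \<forall>b l. coeff (cd_eval (w i) b) l = 0")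
    case True
    then have "w i = 0" if "i \<in> J" for i
      using that by (intro cd_eqI) (simp add: poly_eq_iff)
    then show ?thesis by simp
  next
    case False
    then obtain j b l where j: "j \<in> J" and c: "coeff (cd_eval (w j) b) l \<noteq> 0" by blast
    define c where "c i = coeff (cd_eval (w i) b) l" for i
    \<comment> \<open>These are the coefficients that express \<open>v j\<close> through the other
      left factors. Moved across the tensor sign, they act on \<open>w j\<close> and merge with the
      remaining right factors.\<close>
    define d where "d i = - c i / c j" for i
    have "(\<Sum>i\<in>J. cscale (c i) (v i)) = 0"
      using rel unfolding c_def .
    then have "cscale (c j) (v j) + (\<Sum>i\<in>J - {j}. cscale (c i) (v i)) = 0"
      using j Suc.prems by (simp add: sum.remove)
    then have "cscale (1 / c j) (cscale (c j) (v j) + (\<Sum>i\<in>J - {j}. cscale (c i) (v i))) = 0"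
      by simp
    then have "v j + (\<Sum>i\<in>J - {j}. cscale (c i / c j) (v i)) = 0"
      using c by (simp add: c_def pscale_add_right pm.scale_sum_right pscale_pscale
          flip: one_pCons add: pscale_one)
    then have "v j = - (\<Sum>i\<in>J - {j}. cscale (c i / c j) (v i))"
      by (simp only: eq_neg_iff_add_eq_0)
    moreover have d: "cscale (d i) x = - cscale (c i / c j) x" for i and x :: "'l conformal_dual"
      using pm.scale_minus_left[of "[:c i / c j:]" x] by (simp add: d_def)
    ultimately have "v j = (\<Sum>i\<in>J - {j}. cscale (d i) (v i))"
      by (simp only: d sum_negf)
    then have "v j \<otimes> w j = (\<Sum>i\<in>J - {j}. v i \<otimes> cscale (d i) (w j))"
      by (simp add: pure_sum_left pure_cscale)
    then have eq: "(\<Sum>i\<in>J. v i \<otimes> w i) = (\<Sum>i\<in>J - {j}. v i \<otimes> (w i + cscale (d i) (w j)))"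
      using j Suc.prems by (simp add: sum.remove pure_add_right sum.distrib add.commute)
    show ?thesis unfolding eq
      by (rule Suc.hyps) (use j Suc.prems Suc.hyps(2) eq in auto)
  qed
qed

text \<open>The difference is a finite sum of pure tensors with zero evaluations. Allowing different
  \<open>V\<close> and \<open>W\<close> makes coproducts of one functional in different good
  submodules comparable.\<close>

lemma is_coproduct_unique:
  fixes br :: "'l::del_module \<Rightarrow> 'l \<Rightarrow> 'l poly"
  assumes "is_coproduct br V f s" "is_coproduct br W f t"
  shows "s = t"
proof -
  have "s \<in> tensor_sub UNIV UNIV" "- t \<in> tensor_sub UNIV UNIV"
    using assms tensor_sub_mono[of _ UNIV _ UNIV]
    by (auto simp: is_coproduct_def intro!: tensor_sub_uminus)
  then have "s - t \<in> tensor_sub UNIV UNIV"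
    using tensor_sub_add by fastforce
  then obtain n :: nat and v w where eq: "s - t = (\<Sum>i<n. v i \<otimes> w i)"
    unfolding tensor_sub_def by blast
  have "tensor_eval a b (s - t) = 0" for a b
    using assms by (simp add: is_coproduct_def tensor_eval_diff)
  then have "s - t = 0"
    unfolding eq by (intro pure_sum_eq_0) auto
  then show ?thesis by simp
qed

lemma good_coproduct_eq: "is_coproduct br V f t \<Longrightarrow> good_coproduct br V f = t"
  unfolding good_coproduct_def by (blast intro: is_coproduct_unique)

lemma is_coproduct_mono: "is_coproduct br V f t \<Longrightarrow> V \<subseteq> W \<Longrightarrow> is_coproduct br W f t"
  using tensor_sub_mono unfolding is_coproduct_def by blast

section \<open>Sums of good submodules\<close>

lemma is_coproduct_0: "is_coproduct br V 0 0"
  by (auto simp: is_coproduct_def tensor_sub_0 poly_eq_iff coeff_map_poly)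

lemma is_coproduct_add:
  assumes "is_coproduct br V f s" "is_coproduct br V g t"
  shows "is_coproduct br V (f + g) (s + t)"
proof -
  have "map_poly (cd_eval (f + g)) r = map_poly (cd_eval f) r + map_poly (cd_eval g) r" for r
    by (rule poly_eqI) (simp add: coeff_map_poly cd_eval_add)
  then show ?thesis
    using assms by (simp add: is_coproduct_def tensor_sub_add tensor_eval_add)
qed

text \<open>A multiple of an element of \<open>V\<close> stays in \<open>V\<close> and so has a
  coproduct there; coproducts of sums are obtained by adding.\<close>

lemma good_span_Union:
  assumes "\<And>V. V \<in> \<V> \<Longrightarrow> good br V"
  shows "good br (pm.span (\<Union>\<V>))"
  unfolding good_def
proof (intro conjI ballI)
  fix f assume "f \<in> pm.span (\<Union>\<V>)"
  then show "\<exists>t. is_coproduct br (pm.span (\<Union>\<V>)) f t"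
  proof (induction rule: pm.span_induct_alt)
    case base
    show ?case using is_coproduct_0 by blast
  next
    case (step p f g)
    then obtain V where V: "V \<in> \<V>" "f \<in> V" by blast
    then obtain t where "is_coproduct br V (p *\<^sub>\<partial> f) t"
      using assms[of V] unfolding good_def by (meson pm.subspace_scale)
    moreover have "V \<subseteq> pm.span (\<Union>\<V>)"
      using V(1) pm.span_superset by blast
    ultimately have "is_coproduct br (pm.span (\<Union>\<V>)) (p *\<^sub>\<partial> f) t"
      by (rule is_coproduct_mono)
    moreover obtain u where "is_coproduct br (pm.span (\<Union>\<V>)) g u"
      using step by blast
    ultimately show ?case
      using is_coproduct_add by blast
  qed
qed simp

lemma good_upper_zero: "good br (upper_zero br)"
  unfolding upper_zero_def by (rule good_span_Union) simp

lemma good_subset_upper_zero: "good br V \<Longrightarrow> V \<subseteq> upper_zero br"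
  unfolding upper_zero_def using pm.span_superset[of "\<Union>{V. good br V}"] by blast


section \<open>Finite-rank subcoalgebras\<close>

text \<open>By uniqueness, the coproduct taken in \<open>upper_zero br\<close> is also the one in
  any good submodule containing the functional. Thus \<open>Loc\<close> is the sum of the good
  submodules of finite rank.\<close>

lemma subcoalgebra_iff_good:
  "subcoalgebra (upper_zero br) (good_coproduct br (upper_zero br)) B \<longleftrightarrow> good br B"
proof
  assume B: "subcoalgebra (upper_zero br) (good_coproduct br (upper_zero br)) B"
  have "\<exists>t. is_coproduct br B f t" if "f \<in> B" for f
  proof -
    obtain t where t: "is_coproduct br (upper_zero br) f t"
      using B good_upper_zero \<open>f \<in> B\<close> unfolding subcoalgebra_def good_def by blast
    then have "t \<in> tensor_sub B B"
      using B \<open>f \<in> B\<close> good_coproduct_eq[OF t] unfolding subcoalgebra_def by blast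
    then show ?thesis using t unfolding is_coproduct_def by blast
  qed
  then show "good br B" using B unfolding good_def subcoalgebra_def by blast
next
  assume B: "good br B"
  have "good_coproduct br (upper_zero br) f \<in> tensor_sub B B" if "f \<in> B" for f
  proof -
    obtain t where t: "is_coproduct br B f t"
      using B \<open>f \<in> B\<close> unfolding good_def by blast
    then show ?thesis
      using good_coproduct_eq[OF is_coproduct_mono[OF t good_subset_upper_zero[OF B]]]
      unfolding is_coproduct_def by simp
  qed
  then show "subcoalgebra (upper_zero br) (good_coproduct br (upper_zero br)) B"
    using B good_subset_upper_zero unfolding subcoalgebra_def good_def by blast
qed

text \<open>The torsion summand vanishes because the conformal dual is torsion-free, so the free
  generators suffice.\<close>

lemma finite_rank_imp_finitely_generated:
  fixes B :: "'l::del_module conformal_dual set"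
  assumes "finite_rank B" "pm.subspace B"
  shows "\<exists>G. finite G \<and> B = pm.span G"
proof -
  obtain n :: nat and a where a: "\<And>i. i < n \<Longrightarrow> a i \<in> B"
    "\<And>x. x \<in> B \<Longrightarrow> \<exists>p. \<exists>t\<in>torsion_mod B {0}. x = (\<Sum>i<n. p i *\<^sub>\<partial> a i) + t"
    using assms(1) unfolding finite_rank_def finite_rank_quotient_def by blast
  have "torsion_mod B {0} \<subseteq> {0}"
    using conformal_dual_torsion_free by (auto simp: torsion_mod_def)
  then have "\<exists>p. x = (\<Sum>i<n. p i *\<^sub>\<partial> a i)" if "x \<in> B" for x
    using a(2)[OF that] by fastforce
  then have "B \<subseteq> pm.span (a ` {..<n})"
    by (metis (no_types, lifting) imageI pm.span_base pm.span_scale pm.span_sum subsetI)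
  moreover have "pm.span (a ` {..<n}) \<subseteq> B"
    using a(1) assms(2) by (intro pm.span_minimal) auto
  ultimately show ?thesis by (intro exI[of _ "a ` {..<n}"]) auto
qed

text \<open>
  Each functional splits off a free summand of rank at most one, since its image is a principal
  ideal of \<open>\<complex>[\<lambda>]\<close>.
\<close>

lemma common_kernel_complement:
  fixes G :: "'l::del_module conformal_dual set"
  assumes "finite G" "pm.subspace M"
  shows "\<exists>(n::nat) a. (\<forall>i<n. a i \<in> M) \<and>
    (\<forall>p. (\<Sum>i<n. p i *\<^sub>\<partial> a i) \<in> M \<inter> (\<Inter>g\<in>G. cd_ker g) \<longrightarrow> (\<forall>i<n. p i = 0)) \<and>
    (\<forall>x\<in>M. \<exists>p. x - (\<Sum>i<n. p i *\<^sub>\<partial> a i) \<in> M \<inter> (\<Inter>g\<in>G. cd_ker g))"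
  using assms
\<comment> \<open>\<open>M\<close> is generalized because the hypothesis is applied to the kernel of
  \<open>g\<close> in \<open>M\<close>.\<close>
proof (induction G arbitrary: M rule: finite_induct)
  case empty
  show ?case by (rule exI[of _ 0]) simp
next
  case (insert g G)
  let ?K = "M \<inter> cd_ker g" and ?N = "M \<inter> (\<Inter>g\<in>insert g G. cd_ker g)"
  have N: "?K \<inter> (\<Inter>g\<in>G. cd_ker g) = ?N" by blast
  have K: "pm.subspace ?K"
    using insert.prems subspace_cd_ker by (rule pm.subspace_inter)
  obtain n :: nat and a where a: "\<forall>i<n. a i \<in> ?K"
    "\<forall>p. (\<Sum>i<n. p i *\<^sub>\<partial> a i) \<in> ?N \<longrightarrow> (\<forall>i<n. p i = 0)"
    "\<forall>x\<in>?K. \<exists>p. x - (\<Sum>i<n. p i *\<^sub>\<partial> a i) \<in> ?N"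
    using insert.IH[OF K] unfolding N by (elim exE conjE) (rule that)
  show ?case
  proof (cases "M \<subseteq> cd_ker g")
    case True
    then have KM: "?K = M" by blast
    show ?thesis by (intro exI[of _ n] exI[of _ a] conjI a[unfolded KM])
  next
    case False
    then obtain x1 where "x1 \<in> M \<and> cd_eval g x1 \<noteq> 0" by (auto simp: cd_ker_def)
    \<comment> \<open>A nonzero value of least degree generates the image of \<open>M\<close> under
      \<open>g\<close>.\<close>
    then obtain x0 where x0: "x0 \<in> M" "cd_eval g x0 \<noteq> 0"
      and min: "\<And>y. y \<in> M \<Longrightarrow> cd_eval g y \<noteq> 0 \<Longrightarrow> degree (cd_eval g x0) \<le> degree (cd_eval g y)"
      using ex_has_least_nat[of "\<lambda>x. x \<in> M \<and> cd_eval g x \<noteq> 0" x1 "\<lambda>x. degree (cd_eval g x)"]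
      by blast
    let ?a = "a(n := x0)"
    have sum: "(\<Sum>i<Suc n. p i *\<^sub>\<partial> ?a i) = (\<Sum>i<n. p i *\<^sub>\<partial> a i) + p n *\<^sub>\<partial> x0" for p
      by simp
    have sumK: "(\<Sum>i<n. p i *\<^sub>\<partial> a i) \<in> ?K" for p
      by (intro pm.subspace_sum[OF K] pm.subspace_scale[OF K]) (use a(1) in simp)
    have "\<forall>i<Suc n. p i = 0" if "(\<Sum>i<Suc n. p i *\<^sub>\<partial> ?a i) \<in> ?N" for p
    proof -
      \<comment> \<open>Applying \<open>g\<close> kills the old generators and isolates the
        coefficient of \<open>x0\<close>.\<close>
      have "cd_eval g ((\<Sum>i<n. p i *\<^sub>\<partial> a i) + p n *\<^sub>\<partial> x0) = 0"
        using that unfolding sum cd_ker_def by blast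
      then have "p n * cd_eval g x0 = 0"
        using sumK[of p] by (simp add: cd_eval_arg_add cd_eval_arg_pscale cd_ker_def)
      then have "p n = 0" using x0 by simp
      then have "\<forall>i<n. p i = 0" using a(2) that unfolding sum by simp
      then show ?thesis using \<open>p n = 0\<close> by (simp add: less_Suc_eq)
    qed
    moreover have "\<exists>p. x - (\<Sum>i<Suc n. p i *\<^sub>\<partial> ?a i) \<in> ?N" if "x \<in> M" for x
    proof -
      define q where "q = cd_eval g x div cd_eval g x0"
      have y: "x - q *\<^sub>\<partial> x0 \<in> M"
        using that x0 insert.prems by (intro pm.subspace_diff pm.subspace_scale)
      have gy: "cd_eval g (x - q *\<^sub>\<partial> x0) = cd_eval g x mod cd_eval g x0"
        by (simp add: cd_eval_arg_diff cd_eval_arg_pscale q_def minus_div_mult_eq_mod)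
      \<comment> \<open>A nonzero remainder would be a value of \<open>g\<close> on \<open>M\<close>
        of degree below the minimum.\<close>
      have "cd_eval g (x - q *\<^sub>\<partial> x0) = 0"
        using min[OF y] degree_mod_less[OF x0(2), of "cd_eval g x"]
        unfolding gy by (meson leD)
      with y have "x - q *\<^sub>\<partial> x0 \<in> ?K" by (simp add: cd_ker_def)
      then obtain p where "x - q *\<^sub>\<partial> x0 - (\<Sum>i<n. p i *\<^sub>\<partial> a i) \<in> ?N"
        using bspec[OF a(3)] by blast
      moreover have "(\<Sum>i<Suc n. (p(n := q)) i *\<^sub>\<partial> ?a i) = q *\<^sub>\<partial> x0 + (\<Sum>i<n. p i *\<^sub>\<partial> a i)"
        unfolding sum by (simp add: add.commute)
      ultimately have "x - (\<Sum>i<Suc n. (p(n := q)) i *\<^sub>\<partial> ?a i) \<in> ?N"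
        by (simp only: diff_diff_eq)
      then show ?thesis by blast
    qed
    moreover have "\<forall>i<Suc n. ?a i \<in> M" using a(1) x0 by (auto simp: less_Suc_eq)
    ultimately show ?thesis by (intro exI[of _ "Suc n"] exI[of _ ?a]) blast
  qed
qed

lemma subset_torsion_mod: "N \<subseteq> M \<Longrightarrow> N \<subseteq> torsion_mod M N"
  using pscale_one unfolding torsion_mod_def by (auto intro!: exI[of _ "1 :: complex poly"])

text \<open>With \<open>M = UNIV\<close> the complement is a basis of the quotient; the remainder
  lies in the kernel itself and serves as the torsion term.\<close>

lemma cofinite_rank_common_kernel:
  assumes "finite G"
  shows "cofinite_rank (\<Inter>g\<in>G. cd_ker g)"
proof -
  let ?I = "\<Inter>g\<in>G. cd_ker g"
  obtain n :: nat and a where a: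
    "\<And>p. (\<Sum>i<n. p i *\<^sub>\<partial> a i) \<in> ?I \<Longrightarrow> \<forall>i<n. p i = 0"
    "\<And>x. \<exists>p. x - (\<Sum>i<n. p i *\<^sub>\<partial> a i) \<in> ?I"
    using common_kernel_complement[OF assms pm.subspace_UNIV] by auto
  have "\<exists>p. \<exists>t\<in>torsion_mod UNIV ?I. x = (\<Sum>i<n. p i *\<^sub>\<partial> a i) + t" for x
  proof -
    obtain p where p: "x - (\<Sum>i<n. p i *\<^sub>\<partial> a i) \<in> ?I" using a(2) by blast
    show ?thesis
      by (rule exI[of _ p], rule bexI[of _ "x - (\<Sum>i<n. p i *\<^sub>\<partial> a i)"])
        (use p subset_torsion_mod[of ?I UNIV] in auto)
  qed
  then show ?thesis using a(1) unfolding cofinite_rank_def finite_rank_quotient_def by blast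
qed

text \<open>The right factors of the coproduct of \<open>g\<close> lie in \<open>pm.span G\<close>
  and therefore vanish at \<open>b\<close>; hence \<open>g\<close> vanishes on every coefficient of
  \<open>br a b\<close>.\<close>

lemma lca_ideal_common_kernel:
  fixes br :: "'l::del_module \<Rightarrow> 'l \<Rightarrow> 'l poly"
  assumes "good br (pm.span G)"
  shows "lca_ideal br (\<Inter>g\<in>G. cd_ker g)"
  unfolding lca_ideal_def
proof (intro conjI allI ballI INT_I)
  show "pm.subspace (\<Inter>g\<in>G. cd_ker g)"
    using subspace_cd_ker by (intro pm.subspace_Inter) auto
next
  fix a b n g
  assume b: "b \<in> (\<Inter>g\<in>G. cd_ker g)" and g: "g \<in> G"
  have span: "cd_eval h b = 0" if "h \<in> pm.span G" for h
  proof -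
    have "pm.span G \<subseteq> {h. {b} \<subseteq> cd_ker h}"
      using b by (intro pm.span_minimal subspace_annihilator) auto
    then show ?thesis using that by (auto simp: cd_ker_def)
  qed
  obtain t where "is_coproduct br (pm.span G) g t"
    using assms g pm.span_base unfolding good_def by blast
  then obtain m :: nat and v w where w: "\<And>i. i < m \<Longrightarrow> w i \<in> pm.span G"
    and t: "t = (\<Sum>i<m. v i \<otimes> w i)" and "map_poly (cd_eval g) (br a b) = tensor_eval a b t"
    unfolding is_coproduct_def tensor_sub_def by blast
  then have "map_poly (cd_eval g) (br a b) = 0"
    using span by (simp add: tensor_eval_sum tensor_eval_pure)
  then have "coeff (map_poly (cd_eval g) (br a b)) n = 0" by simp
  then show "coeff (br a b) n \<in> cd_ker g"
    by (simp add: coeff_map_poly cd_ker_def)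
qed

text \<open>A span element involves finitely many of the submodules. Finite generation passes to
  their sum by uniting the generating sets, and goodness by \<open>good_span_Union\<close>.\<close>

lemma Loc_upper_zero_imp_finitely_generated:
  assumes "f \<in> Loc (upper_zero br) (good_coproduct br (upper_zero br))"
  shows "\<exists>G. finite G \<and> good br (pm.span G) \<and> f \<in> pm.span G"
  using assms unfolding Loc_def subcoalgebra_iff_good
proof (induction rule: pm.span_induct_alt)
  case base
  have "good br (pm.span {})"
    using is_coproduct_0 by (auto simp: good_def)
  then show ?case by (intro exI[of _ "{}"]) simp
next
  case (step p f g)
  then obtain B where B: "good br B" "finite_rank B" "f \<in> B" by blast
  then obtain H where H: "finite H" "B = pm.span H"
    using finite_rank_imp_finitely_generated unfolding good_def by blast
  obtain G where G: "finite G" "good br (pm.span G)" "g \<in> pm.span G" using step by blast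
  have span: "pm.span (\<Union>{pm.span H, pm.span G}) = pm.span (H \<union> G)"
    by (intro subset_antisym pm.span_minimal)
      (auto intro: pm.span_superset[THEN subsetD] pm.span_mono[THEN subsetD, rotated])
  have "good br (pm.span (H \<union> G))"
    unfolding span[symmetric] by (rule good_span_Union) (use B H G in auto)
  moreover have "p *\<^sub>\<partial> f + g \<in> pm.span (H \<union> G)"
    using B H G pm.span_mono[of H "H \<union> G"] pm.span_mono[of G "H \<union> G"]
    by (auto intro!: pm.span_add pm.span_scale)
  ultimately show ?case using H G by (intro exI[of _ "H \<union> G"]) simp
qed


section \<open>Annihilators of ideals of cofinite rank\<close>

context lie_conformal_algebra
begin

text \<open>The bracket variable is here \<mu>, so by sesquilinearity \<partial> on the left
  argument acts as -\<mu>.\<close>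

lemma map_cd_eval_pscale_left:
  "map_poly (cd_eval f) (br (p *\<^sub>\<partial> a) b) =
    subst2 p (- var_mu) * map_poly (cd_eval f) (br a b)"
proof (induction p)
  case 0
  have "br 0 b = 0" using add_left[of 0 0 b] by simp
  then show ?case by simp
next
  case (pCons c p)
  have 1: "map_poly (cd_eval f) (map_poly (cscale c) r) = [:[:c:]:] * map_poly (cd_eval f) r" for r
    by (rule poly_eqI) (simp add: coeff_map_poly cd_eval_cscale)
  have 2: "map_poly (cd_eval f) (r - pCons 0 s) =
      map_poly (cd_eval f) r - var_mu * map_poly (cd_eval f) s" for r s
    by (rule poly_eqI) (simp add: coeff_map_poly cd_eval_arg_diff coeff_pCons split: nat.split)
  have "br (pCons c p *\<^sub>\<partial> a) b = map_poly (cscale c) (br a b) - pCons 0 (br (p *\<^sub>\<partial> a) b)"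
    by (simp only: pscale_pCons[of c p] add_left cscale_left sesquilinear_left diff_conv_add_uminus)
  then show ?case
    by (simp only: 1 2 pCons.IH subst2_pCons) (simp add: algebra_simps)
qed

text \<open>On the right argument \<partial> acts as \<lambda> + \<mu>: \<open>pCons 0\<close>
  contributes \<mu>, and \<open>map_poly del\<close> contributes \<lambda> once \<open>f\<close> is
  applied.\<close>

lemma map_cd_eval_pscale_right:
  "map_poly (cd_eval f) (br a (p *\<^sub>\<partial> b)) =
    subst2 p (var_lambda + var_mu) * map_poly (cd_eval f) (br a b)"
proof (induction p)
  case 0
  have "br a 0 = 0" using add_right[of a 0 0] by simp
  then show ?case by simp
next
  case (pCons c p)
  have 1: "map_poly (cd_eval f) (map_poly (cscale c) r + (pCons 0 s + map_poly del s)) =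
      [:[:c:]:] * map_poly (cd_eval f) r + (var_lambda + var_mu) * map_poly (cd_eval f) s" for r s
    by (rule poly_eqI)
      (simp add: coeff_map_poly cd_eval_arg_add cd_eval_cscale cd_eval_del coeff_pCons distrib_right
        split: nat.split)
  have "br a (pCons c p *\<^sub>\<partial> b) = map_poly (cscale c) (br a b) +
      (pCons 0 (br a (p *\<^sub>\<partial> b)) + map_poly del (br a (p *\<^sub>\<partial> b)))"
    by (simp only: pscale_pCons[of c p] add_right cscale_right sesquilinear_right)
  then show ?case
    by (simp only: 1 pCons.IH subst2_pCons) (simp add: algebra_simps)
qed

lemma map_cd_eval_add_left:
  "map_poly (cd_eval f) (br (a + a') b) = map_poly (cd_eval f) (br a b) + map_poly (cd_eval f) (br a' b)"
  by (rule poly_eqI) (simp add: add_left coeff_map_poly cd_eval_arg_add)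

lemma map_cd_eval_add_right:
  "map_poly (cd_eval f) (br a (b + b')) = map_poly (cd_eval f) (br a b) + map_poly (cd_eval f) (br a b')"
  by (rule poly_eqI) (simp add: add_right coeff_map_poly cd_eval_arg_add)

lemma map_cd_eval_sum_left:
  "map_poly (cd_eval f) (br (\<Sum>i\<in>A. p i *\<^sub>\<partial> a i) b) =
    (\<Sum>i\<in>A. subst2 (p i) (- var_mu) * map_poly (cd_eval f) (br (a i) b))"
proof (induction A rule: infinite_finite_induct)
  case (insert x A)
  then show ?case by (simp add: map_cd_eval_add_left map_cd_eval_pscale_left)
qed (use map_cd_eval_pscale_left[of f 0 0 b] in simp_all)

lemma map_cd_eval_sum_right:
  "map_poly (cd_eval f) (br a (\<Sum>i\<in>A. p i *\<^sub>\<partial> b i)) =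
    (\<Sum>i\<in>A. subst2 (p i) (var_lambda + var_mu) * map_poly (cd_eval f) (br a (b i)))"
proof (induction A rule: infinite_finite_induct)
  case (insert x A)
  then show ?case by (simp add: map_cd_eval_add_right map_cd_eval_pscale_right)
qed (use map_cd_eval_pscale_right[of f a 0 0] in simp_all)

text \<open>Skew-symmetry makes an ideal two-sided: the operator substituted for the bracket
  variable preserves polynomials with coefficients in \<open>I\<close>.\<close>

lemma lca_ideal_left:
  assumes "lca_ideal br I" "a \<in> I"
  shows "coeff (br a b) n \<in> I"
proof -
  have I: "pm.subspace I" and b: "\<And>k. coeff (br b a) k \<in> I"
    using assms by (auto simp: lca_ideal_def)
  define X where "X r = - pCons 0 r - map_poly del r" for r :: "'l poly"
  have "coeff ((X ^^ k) [:c:]) n \<in> I" if "c \<in> I" for c k n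
  proof (induction k arbitrary: n)
    case 0
    show ?case using that I by (simp add: coeff_pCons pm.subspace_0 split: nat.split)
  next
    case (Suc k)
    have "coeff (pCons 0 r) n \<in> I" if "\<And>m. coeff r m \<in> I" for r :: "'l poly"
      using that I by (simp add: coeff_pCons pm.subspace_0 split: nat.split)
    then have "coeff (pCons 0 ((X ^^ k) [:c:])) n \<in> I"
      using Suc by blast
    moreover have "coeff (X r) n = - coeff (pCons 0 r) n - del (coeff r n)" for r
      by (simp only: X_def coeff_diff coeff_minus) (simp add: coeff_map_poly)
    ultimately show ?case
      using Suc[of n] by (simp only: funpow.simps o_apply)
        (intro pm.subspace_diff[OF I] pm.subspace_neg[OF I] pm.subspace_scale[OF I])
  qed
  then have "coeff (poly_act X (\<lambda>c. [:c:]) (br b a)) n \<in> I"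
    using b unfolding poly_act_def coeff_sum by (intro pm.subspace_sum[OF I]) auto
  moreover have "br a b = - poly_act X (\<lambda>c. [:c:]) (br b a)"
    unfolding X_def by (rule skew_symmetry)
  ultimately show ?thesis
    using pm.subspace_neg[OF I] by (simp only: coeff_minus)
qed

text \<open>Some nonzero \<open>p\<close> moves \<open>t\<close> into \<open>I\<close>, where the
  bracket is killed by \<open>f\<close>; the resulting factor p(-\<mu>) is nonzero and
  cancels.\<close>

lemma map_cd_eval_torsion_left:
  assumes "lca_ideal br I" "I \<subseteq> cd_ker f" "t \<in> torsion_mod UNIV I"
  shows "map_poly (cd_eval f) (br t b) = 0"
proof -
  obtain p where p: "p \<noteq> 0" "p *\<^sub>\<partial> t \<in> I" using assms(3) by (auto simp: torsion_mod_def)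
  have "map_poly (cd_eval f) (br (p *\<^sub>\<partial> t) b) = 0"
    using lca_ideal_left[OF assms(1) p(2)] assms(2)
    by (intro poly_eqI) (auto simp: coeff_map_poly cd_ker_def subset_iff)
  then show ?thesis
    using p(1) subst2_neg_mu_eq_0 by (auto simp: map_cd_eval_pscale_left)
qed

lemma map_cd_eval_torsion_right:
  assumes "lca_ideal br I" "I \<subseteq> cd_ker f" "t \<in> torsion_mod UNIV I"
  shows "map_poly (cd_eval f) (br a t) = 0"
proof -
  obtain p where p: "p \<noteq> 0" "p *\<^sub>\<partial> t \<in> I" using assms(3) by (auto simp: torsion_mod_def)
  have "map_poly (cd_eval f) (br a (p *\<^sub>\<partial> t)) = 0"
    using assms(1,2) p(2)
    by (intro poly_eqI) (auto simp: coeff_map_poly cd_ker_def lca_ideal_def subset_iff)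
  then show ?thesis
    using p(1) subst2_lambda_mu_eq_0 by (auto simp: map_cd_eval_pscale_right)
qed

end

text \<open>
  Since \<open>\<complex>[\<lambda>,\<mu>] = \<complex>[-\<mu>, \<lambda> + \<mu>]\<close>, a multiplier can be absorbed into the two factors.
\<close>

lemma tensor_eval_multiple:
  fixes f g :: "'l::del_module conformal_dual"
  assumes "pm.subspace V" "f \<in> V" "g \<in> V"
  shows "\<exists>t\<in>tensor_sub V V. \<forall>a b. tensor_eval a b t = r * tensor_eval a b (f \<otimes> g)"
proof -
  \<comment> \<open>The quantifiers over \<open>f\<close> and \<open>g\<close> let the induction
    replace them by multiples that have absorbed a linear factor.\<close>
  define P where "P r \<longleftrightarrow> (\<forall>f\<in>V. \<forall>g\<in>V. \<exists>t\<in>tensor_sub V V.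
    \<forall>a b. tensor_eval a b t = r * tensor_eval a b (f \<otimes> g))" for r
  have add: "P (r + s)" if r: "P r" and s: "P s" for r s
    unfolding P_def
  proof (intro ballI)
    fix f g assume fg: "f \<in> V" "g \<in> V"
    obtain t where "t \<in> tensor_sub V V" "\<forall>a b. tensor_eval a b t = r * tensor_eval a b (f \<otimes> g)"
      using r fg unfolding P_def by blast
    moreover obtain u where "u \<in> tensor_sub V V"
      "\<forall>a b. tensor_eval a b u = s * tensor_eval a b (f \<otimes> g)"
      using s fg unfolding P_def by blast
    ultimately show "\<exists>t\<in>tensor_sub V V. \<forall>a b. tensor_eval a b t = (r + s) * tensor_eval a b (f \<otimes> g)"
      by (intro bexI[of _ "t + u"]) (auto simp: tensor_eval_add tensor_sub_add distrib_right)
  qed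
  have left: "P (r * subst2 [:c, d:] (- var_mu))" if r: "P r" for r c d
    unfolding P_def
  proof (intro ballI)
    fix f g assume fg: "f \<in> V" "g \<in> V"
    \<comment> \<open>The sign of \<open>d\<close> changes because \<partial> acts on functionals as
      -\<lambda>.\<close>
    have "tensor_eval a b (([:c, - d:] *\<^sub>\<partial> f) \<otimes> g) =
        subst2 [:c, d:] (- var_mu) * tensor_eval a b (f \<otimes> g)" for a b
      by (simp add: tensor_eval_pure cd_eval_pscale pcompose_pCons subst2_add subst2_smult
          subst2_pCons algebra_simps flip: smult_minus_left)
    moreover have "[:c, - d:] *\<^sub>\<partial> f \<in> V" using assms(1) fg by (simp add: pm.subspace_scale)
    then obtain t where "t \<in> tensor_sub V V"
      "\<forall>a b. tensor_eval a b t = r * tensor_eval a b (([:c, - d:] *\<^sub>\<partial> f) \<otimes> g)"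
      using r fg unfolding P_def by blast
    ultimately show "\<exists>t\<in>tensor_sub V V. \<forall>a b. tensor_eval a b t =
        r * subst2 [:c, d:] (- var_mu) * tensor_eval a b (f \<otimes> g)"
      by (intro bexI[of _ t]) (simp_all only: mult.assoc simp_thms)
  qed
  have right: "P (r * subst2 [:0, 1:] (var_lambda + var_mu))" if r: "P r" for r
    unfolding P_def
  proof (intro ballI)
    fix f g assume fg: "f \<in> V" "g \<in> V"
    have "tensor_eval a b (f \<otimes> ([:0, - 1:] *\<^sub>\<partial> g)) =
        subst2 [:0, 1:] (var_lambda + var_mu) * tensor_eval a b (f \<otimes> g)" for a b
      by (simp add: tensor_eval_pure cd_eval_pscale pcompose_pCons subst2_add subst2_smult
          subst2_pCons algebra_simps)
    moreover have "[:0, - 1:] *\<^sub>\<partial> g \<in> V" using assms(1) fg by (simp add: pm.subspace_scale)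
    then obtain t where "t \<in> tensor_sub V V"
      "\<forall>a b. tensor_eval a b t = r * tensor_eval a b (f \<otimes> ([:0, - 1:] *\<^sub>\<partial> g))"
      using r fg unfolding P_def by blast
    ultimately show "\<exists>t\<in>tensor_sub V V. \<forall>a b. tensor_eval a b t =
        r * subst2 [:0, 1:] (var_lambda + var_mu) * tensor_eval a b (f \<otimes> g)"
      by (intro bexI[of _ t]) (simp_all only: mult.assoc simp_thms)
  qed
  have one: "P 1" unfolding P_def by (auto intro: tensor_sub_pure)
  have const: "P [:[:c:]:]" for c
    using left[OF one, of c 0] by (simp add: subst2_pCons)
  have mu: "P (r * var_mu)" if "P r" for r
    using left[OF that, of 0 "- 1"] by (simp add: subst2_pCons)
  have lambda: "P (r * var_lambda)" if "P r" for r
  proof -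
    have "var_lambda = subst2 [:0, 1:] (var_lambda + var_mu) + subst2 [:0, 1:] (- var_mu)"
      by (simp add: subst2_pCons)
    then show ?thesis using add[OF right[OF that] left[OF that]] by (metis distrib_left)
  qed
  \<comment> \<open>Any multiplier is built in Horner form, first in \<lambda> for the coefficients
    and then in \<mu>.\<close>
  have inner: "P [:q:]" for q
  proof (induction q)
    case 0
    show ?case using const[of 0] by simp
  next
    case (pCons c q)
    show ?case using add[OF const[of c] lambda[OF pCons.IH]] by simp
  qed
  have "P r"
  proof (induction r)
    case 0
    show ?case using const[of 0] by simp
  next
    case (pCons q r)
    show ?case using add[OF inner[of q] mu[OF pCons.IH]] by simp
  qed
  then show ?thesis using assms(2,3) unfolding P_def by blast
qed

section \<open>Coordinates modulo torsion\<close>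

lemma subspace_torsion_mod:
  assumes "pm.subspace I"
  shows "pm.subspace (torsion_mod UNIV I)"
  unfolding pm.subspace_def
proof (intro conjI ballI allI)
  show "0 \<in> torsion_mod UNIV I"
    using subset_torsion_mod[of I UNIV] pm.subspace_0[OF assms] by blast
next
  fix x y assume "x \<in> torsion_mod UNIV I" "y \<in> torsion_mod UNIV I"
  then obtain p q where p: "p \<noteq> 0" "p *\<^sub>\<partial> x \<in> I" and q: "q \<noteq> 0" "q *\<^sub>\<partial> y \<in> I"
    by (auto simp: torsion_mod_def)
  have "(p * q) *\<^sub>\<partial> (x + y) = q *\<^sub>\<partial> p *\<^sub>\<partial> x + p *\<^sub>\<partial> q *\<^sub>\<partial> y"
    by (simp add: pscale_add_right pscale_pscale mult.commute)
  also have "\<dots> \<in> I"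
    by (intro pm.subspace_add[OF assms] pm.subspace_scale[OF assms p(2)] pm.subspace_scale[OF assms q(2)])
  finally show "x + y \<in> torsion_mod UNIV I"
    using p q unfolding torsion_mod_def by (auto intro!: exI[of _ "p * q"])
next
  fix r x assume "x \<in> torsion_mod UNIV I"
  then obtain p where p: "p \<noteq> 0" "p *\<^sub>\<partial> x \<in> I" by (auto simp: torsion_mod_def)
  have "p *\<^sub>\<partial> r *\<^sub>\<partial> x = r *\<^sub>\<partial> p *\<^sub>\<partial> x"
    by (simp add: pscale_pscale mult.commute)
  also have "\<dots> \<in> I" by (rule pm.subspace_scale[OF assms p(2)])
  finally show "r *\<^sub>\<partial> x \<in> torsion_mod UNIV I"
    using p unfolding torsion_mod_def by auto
qed

text \<open>The coordinates of a vector in the free part of the quotient are unique, hence linear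
  over \<complex>[\<partial>]; reading \<partial> as \<lambda> turns them into conformal
  functionals.\<close>

lemma coordinate_functionals:
  fixes I :: "'l::del_module set"
  assumes "pm.subspace I" "cofinite_rank I"
  obtains n :: nat and e :: "nat \<Rightarrow> 'l conformal_dual" and a :: "nat \<Rightarrow> 'l"
  where "\<And>i j. i < n \<Longrightarrow> j < n \<Longrightarrow> cd_eval (e i) (a j) = (if i = j then 1 else 0)"
    and "\<And>i. i < n \<Longrightarrow> I \<subseteq> cd_ker (e i)"
    and "\<And>x. x - (\<Sum>i<n. cd_eval (e i) x *\<^sub>\<partial> a i) \<in> torsion_mod UNIV I"
proof -
  let ?T = "torsion_mod UNIV I"
  have T: "pm.subspace ?T" by (rule subspace_torsion_mod[OF assms(1)])
  obtain n :: nat and a where ind: "\<And>p. (\<Sum>i<n. p i *\<^sub>\<partial> a i) \<in> I \<Longrightarrow> \<forall>i<n. p i = 0"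
    and gen: "\<And>x. \<exists>p. \<exists>t\<in>?T. x = (\<Sum>i<n. p i *\<^sub>\<partial> a i) + t"
    using assms(2) unfolding cofinite_rank_def finite_rank_quotient_def by blast
  \<comment> \<open>Clearing a denominator \<open>q\<close> upgrades independence modulo
    \<open>I\<close> to independence modulo torsion.\<close>
  have indT: "\<forall>i<n. p i = 0" if t: "(\<Sum>i<n. p i *\<^sub>\<partial> a i) \<in> ?T" for p
  proof -
    obtain q where q: "q \<noteq> 0" "q *\<^sub>\<partial> (\<Sum>i<n. p i *\<^sub>\<partial> a i) \<in> I"
      using t by (auto simp: torsion_mod_def)
    then have "\<forall>i<n. q * p i = 0"
      by (intro ind) (simp add: pm.scale_sum_right)
    then show ?thesis using q by simp
  qed
  define c where "c x = (SOME p. x - (\<Sum>i<n. p i *\<^sub>\<partial> a i) \<in> ?T)" for x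
  have c: "x - (\<Sum>i<n. c x i *\<^sub>\<partial> a i) \<in> ?T" for x
  proof -
    have "\<exists>p. x - (\<Sum>i<n. p i *\<^sub>\<partial> a i) \<in> ?T"
      using gen[of x] by (metis add_diff_cancel_left')
    then show ?thesis unfolding c_def by (rule someI_ex)
  qed
  have c_eq: "c x i = p i" if p: "x - (\<Sum>i<n. p i *\<^sub>\<partial> a i) \<in> ?T" and i: "i < n" for x p i
  proof -
    have "(\<Sum>i<n. (c x i - p i) *\<^sub>\<partial> a i) =
        (x - (\<Sum>i<n. p i *\<^sub>\<partial> a i)) - (x - (\<Sum>i<n. c x i *\<^sub>\<partial> a i))"
      by (simp add: pm.scale_left_diff_distrib sum_subtractf)
    also have "\<dots> \<in> ?T" by (rule pm.subspace_diff[OF T p c])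
    finally show ?thesis using indT i by fastforce
  qed
  have c_add: "c (x + y) i = c x i + c y i" if "i < n" for x y i
  proof (rule c_eq[OF _ that])
    have "x + y - (\<Sum>i<n. (c x i + c y i) *\<^sub>\<partial> a i) =
        (x - (\<Sum>i<n. c x i *\<^sub>\<partial> a i)) + (y - (\<Sum>i<n. c y i *\<^sub>\<partial> a i))"
      by (simp add: pscale_add_left sum.distrib)
    then show "x + y - (\<Sum>i<n. (c x i + c y i) *\<^sub>\<partial> a i) \<in> ?T"
      by (simp only: pm.subspace_add[OF T c c])
  qed
  have c_scale: "c (r *\<^sub>\<partial> x) i = r * c x i" if "i < n" for r x i
  proof (rule c_eq[OF _ that])
    have "r *\<^sub>\<partial> x - (\<Sum>i<n. (r * c x i) *\<^sub>\<partial> a i) = r *\<^sub>\<partial> (x - (\<Sum>i<n. c x i *\<^sub>\<partial> a i))"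
      by (simp add: pm.scale_right_diff_distrib pm.scale_sum_right)
    then show "r *\<^sub>\<partial> x - (\<Sum>i<n. (r * c x i) *\<^sub>\<partial> a i) \<in> ?T"
      by (simp only: pm.subspace_scale[OF T c])
  qed
  \<comment> \<open>Only indices below \<open>n\<close> matter: beyond them the chosen
    \<open>c x i\<close> are unconstrained.\<close>
  define e where "e i = Abs_cd (\<lambda>x. c x i)" for i
  have e: "cd_eval (e i) x = c x i" if "i < n" for i x
    unfolding e_def using that by (subst Abs_cd_inverse) (simp_all add: c_add c_scale)
  show thesis
  proof
    fix i j assume ij: "i < n" "j < n"
    have "(\<Sum>k<n. (if k = j then 1 else 0) *\<^sub>\<partial> a k) = (\<Sum>k<n. if k = j then a k else 0)"
      by (intro sum.cong) auto
    then have "a j - (\<Sum>k<n. (if k = j then 1 else 0) *\<^sub>\<partial> a k) \<in> ?T"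
      using ij pm.subspace_0[OF T] by simp
    from c_eq[OF this ij(1)] show "cd_eval (e i) (a j) = (if i = j then 1 else 0)"
      using ij by (simp add: e)
  next
    fix i assume i: "i < n"
    have "c x i = 0" if "x \<in> I" for x
      by (rule c_eq[of x "\<lambda>_. 0", OF _ i]) (use that subset_torsion_mod[of I UNIV] in auto)
    then show "I \<subseteq> cd_ker (e i)" using i by (auto simp: cd_ker_def e)
  next
    fix x
    show "x - (\<Sum>i<n. cd_eval (e i) x *\<^sub>\<partial> a i) \<in> ?T" using c[of x] by (simp add: e)
  qed
qed

text \<open>The annihilator of \<open>I\<close> is the finite-rank subcoalgebra that places every
  functional vanishing on \<open>I\<close> in \<open>Loc\<close>.\<close>

lemma (in lie_conformal_algebra) annihilator_good_finite_rank:
  assumes I: "lca_ideal br I" and "cofinite_rank I"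
  shows "good br {g. I \<subseteq> cd_ker g}" "finite_rank {g. I \<subseteq> cd_ker g}"
proof -
  let ?B = "{g. I \<subseteq> cd_ker g}" and ?T = "torsion_mod UNIV I"
  have "pm.subspace I" using I by (simp add: lca_ideal_def)
  then obtain n :: nat and e :: "nat \<Rightarrow> 'l conformal_dual" and a :: "nat \<Rightarrow> 'l"
    where dual: "\<And>i j. i < n \<Longrightarrow> j < n \<Longrightarrow> cd_eval (e i) (a j) = (if i = j then 1 else 0)"
      and eB: "\<And>i. i < n \<Longrightarrow> I \<subseteq> cd_ker (e i)"
      and dec: "\<And>x. x - (\<Sum>i<n. cd_eval (e i) x *\<^sub>\<partial> a i) \<in> ?T"
    by (rule coordinate_functionals[OF _ assms(2)]) (rule that)
  define T where "T x = x - (\<Sum>i<n. cd_eval (e i) x *\<^sub>\<partial> a i)" for x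
  have T: "T x \<in> ?T" "x = (\<Sum>i<n. cd_eval (e i) x *\<^sub>\<partial> a i) + T x" for x
    using dec by (simp_all add: T_def)
  have torsion: "cd_eval f t = 0" if "I \<subseteq> cd_ker f" "t \<in> ?T" for f t
    using that by (auto simp: torsion_mod_def cd_ker_def cd_eval_arg_pscale subset_iff)

  show "good br ?B"
    unfolding good_def
  proof (intro conjI ballI)
    show "pm.subspace ?B" by (rule subspace_annihilator)
  next
    fix f assume "f \<in> ?B"
    then have f: "I \<subseteq> cd_ker f" by simp
    let ?F = "\<lambda>x y. map_poly (cd_eval f) (br x y)"
    \<comment> \<open>Both arguments are expanded in coordinates, and their torsion parts contribute
      nothing. The values at pairs of basis vectors are arbitrary in \<complex>[\<lambda>,\<mu>] and
      are absorbed by \<open>tensor_eval_multiple\<close>.\<close>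
    have F: "?F x y = (\<Sum>i<n. \<Sum>j<n. ?F (a i) (a j) * tensor_eval x y (e i \<otimes> e j))" for x y
    proof -
      have right: "?F x' y =
          (\<Sum>j<n. subst2 (cd_eval (e j) y) (var_lambda + var_mu) * ?F x' (a j))" for x'
      proof -
        have "?F x' y = ?F x' ((\<Sum>i<n. cd_eval (e i) y *\<^sub>\<partial> a i) + T y)" by (simp flip: T(2))
        then show ?thesis
          by (simp only: map_cd_eval_add_right map_cd_eval_sum_right
              map_cd_eval_torsion_right[OF I f T(1)] add_0_right)
      qed
      have "?F x y = ?F ((\<Sum>i<n. cd_eval (e i) x *\<^sub>\<partial> a i) + T x) y" by (simp flip: T(2))
      also have "\<dots> = (\<Sum>i<n. subst2 (cd_eval (e i) x) (- var_mu) * ?F (a i) y)"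
        by (simp only: map_cd_eval_add_left map_cd_eval_sum_left
            map_cd_eval_torsion_left[OF I f T(1)] add_0_right)
      also have "\<dots> = (\<Sum>i<n. \<Sum>j<n. ?F (a i) (a j) * tensor_eval x y (e i \<otimes> e j))"
        by (simp only: right[of "a _"] tensor_eval_pure sum_distrib_left mult_ac)
      finally show ?thesis .
    qed
    have "\<exists>t\<in>tensor_sub ?B ?B. \<forall>x y. tensor_eval x y t = ?F (a i) (a j) * tensor_eval x y (e i \<otimes> e j)"
      if "i < n" "j < n" for i j
      using that eB by (intro tensor_eval_multiple subspace_annihilator) auto
    then obtain t where t: "\<And>i j. i < n \<Longrightarrow> j < n \<Longrightarrow> t i j \<in> tensor_sub ?B ?B"
      "\<And>i j x y. i < n \<Longrightarrow> j < n \<Longrightarrow>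
        tensor_eval x y (t i j) = ?F (a i) (a j) * tensor_eval x y (e i \<otimes> e j)"
      by metis
    have "is_coproduct br ?B f (\<Sum>i<n. \<Sum>j<n. t i j)"
      unfolding is_coproduct_def
    proof (intro conjI allI)
      show "(\<Sum>i<n. \<Sum>j<n. t i j) \<in> tensor_sub ?B ?B"
        using t(1) by (auto intro!: tensor_sub_sum)
      show "?F x y = tensor_eval x y (\<Sum>i<n. \<Sum>j<n. t i j)" for x y
        by (subst F) (simp add: tensor_eval_sum t(2))
    qed
    then show "\<exists>t. is_coproduct br ?B f t" by blast
  qed

  have "\<forall>i<n. p i = 0" if "(\<Sum>i<n. p i *\<^sub>\<partial> e i) = 0" for p
  proof (intro allI impI)
    fix j assume j: "j < n"
    have "0 = cd_eval (\<Sum>i<n. p i *\<^sub>\<partial> e i) (a j)" using that by simp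
    also have "\<dots> = (\<Sum>i<n. if i = j then pcompose (p i) [:0, -1:] else 0)"
      unfolding cd_eval_sum using j by (intro sum.cong) (auto simp: cd_eval_pscale dual)
    also have "\<dots> = pcompose (p j) [:0, -1:]" using j by simp
    finally have "pcompose (p j) [:0, -1:] = 0" by simp
    then show "p j = 0" by (simp add: pcompose_eq_0_iff)
  qed
  moreover have "\<exists>p. \<exists>t\<in>torsion_mod ?B {0}. f = (\<Sum>i<n. p i *\<^sub>\<partial> e i) + t" if f: "I \<subseteq> cd_ker f" for f
  proof -
    \<comment> \<open>The coefficients are the values \<open>cd_eval f (a i)\<close> with \<lambda>
      negated, since the action on functionals negates the variable once more.\<close>
    have "f = (\<Sum>i<n. pcompose (cd_eval f (a i)) [:0, -1:] *\<^sub>\<partial> e i)"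
    proof (rule cd_eqI)
      fix x
      have "pcompose (pcompose q [:0, -1:]) [:0, -1:] = q" for q :: "complex poly"
        by (simp add: pcompose_pCons flip: pcompose_assoc)
      moreover have "cd_eval f x = cd_eval f ((\<Sum>i<n. cd_eval (e i) x *\<^sub>\<partial> a i) + T x)"
        by (simp flip: T(2))
      ultimately show "cd_eval f x =
          cd_eval (\<Sum>i<n. pcompose (cd_eval f (a i)) [:0, -1:] *\<^sub>\<partial> e i) x"
        using torsion[OF f T(1)]
        by (simp add: cd_eval_arg_add cd_eval_arg_sum cd_eval_arg_pscale cd_eval_sum
            cd_eval_pscale mult.commute)
    qed
    moreover have "0 \<in> torsion_mod ?B {0}"
      by (rule subsetD[OF subset_torsion_mod]) (auto simp: cd_ker_def)
    ultimately show ?thesis by (metis add.right_neutral)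
  qed
  ultimately show "finite_rank ?B"
    unfolding finite_rank_def finite_rank_quotient_def
    using eB by (intro exI[of _ n] exI[of _ e]) auto
qed

theorem theorem4p3:
  fixes br :: "'l::del_module \<Rightarrow> 'l \<Rightarrow> 'l poly"
  assumes "lie_conformal_algebra br"
    and "\<exists>S :: 'l set. pm.independent S \<and> pm.span S = UNIV"
  shows "Loc (upper_zero br) (good_coproduct br (upper_zero br)) =
    {f. \<exists>I. lca_ideal br I \<and> cofinite_rank I \<and> I \<subseteq> cd_ker f}"
proof (intro subset_antisym subsetI CollectI)
  fix f assume "f \<in> Loc (upper_zero br) (good_coproduct br (upper_zero br))"
  then obtain G where G: "finite G" "good br (pm.span G)" "f \<in> pm.span G"
    using Loc_upper_zero_imp_finitely_generated by blast
  let ?I = "\<Inter>g\<in>G. cd_ker g"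
  \<comment> \<open>The functionals vanishing on the common kernel form a submodule containing
    \<open>G\<close>, hence also \<open>f\<close>.\<close>
  have "pm.span G \<subseteq> {h. ?I \<subseteq> cd_ker h}"
    by (intro pm.span_minimal subspace_annihilator) auto
  then show "\<exists>I. lca_ideal br I \<and> cofinite_rank I \<and> I \<subseteq> cd_ker f"
    using G lca_ideal_common_kernel cofinite_rank_common_kernel by blast
next
  fix f assume "f \<in> {f. \<exists>I. lca_ideal br I \<and> cofinite_rank I \<and> I \<subseteq> cd_ker f}"
  then obtain I where I: "lca_ideal br I" "cofinite_rank I" "I \<subseteq> cd_ker f" by blast
  then show "f \<in> Loc (upper_zero br) (good_coproduct br (upper_zero br))"
    using lie_conformal_algebra.annihilator_good_finite_rank[OF assms(1)]
    unfolding Loc_def subcoalgebra_iff_good by (intro pm.span_base) blast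
qed

end
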